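(* Let $X\subseteq\{0,1\}^n$ be a nonempty feasible set, let $m$ be a mass function describing the uncertain cost, and let $\mathrm{Crit}(\cdot\,;\cdot)$ be a real-valued decision criterion to be minimised over $X$. Let $\hat m$ be an approximation of $m$ (another mass function on the same cost frame) that is monotone for the criterion, that is, $$\Delta(x):=\mathrm{Crit}(x;\hat m)-\mathrm{Crit}(x;m)\ \ge\ 0\qquad\text{for all } x\in X.$$ Let $x^\star(m)\in\arg\min_{x\in X}\mathrm{Crit}(x;m)$ and $x^\star(\hat m)\in\arg\min_{x\in X}\mathrm{Crit}(x;\hat m)$ be the decisions under $m$ and $\hat m$, and let $$R(\hat m)=\mathrm{Crit}\big(x^\star(\hat m);m\big)-\mathrm{Crit}\big(x^\star(m);m\big)$$ be the approximation regret. Then $$R(\hat m)\ \le\ \Delta\big(x^\star(m)\big).$$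
   Context: Setting: a linear combinatorial problem $\min_{x\in X}c^\top x$ with $X\subseteq\{0,1\}^n$ (e.g. the set of $s$-to-$t$ paths in a graph), where the cost vector $c$ is uncertain. A mass function $m$ assigns nonnegative masses $m(F)$, summing to $1$, to finitely many focal elements $F$; here focal elements are boxes $F=[\underline a_F,\overline a_F]$ (one cost interval per coordinate) in a finite integer cost grid. A criterion assigns to each $x\in X$ and each mass function $m$ a real number $\mathrm{Crit}(x;m)$. The basic instances are the lower expected cost $$\mathrm{Crit}(x;m)=\sum_F m(F)\min_{c\in F}c^\top x=\sum_F m(F)\,\underline a_F^\top x$$ and the upper expected cost, which is the same with $\overline a_F$ in place of $\underline a_F$ (max in place of min). The decision $x^\star(m)$ is a minimiser of $\mathrm{Crit}(\cdot\,;m)$ over $X$, made unique by a fixed deterministic tie-breaking rule. The approximation regret $R(\hat m)$ is the loss, evaluated under the true $m$, from deciding with $\hat m$ instead of $m$. *)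

theory Defs
  imports "HOL-Analysis.Analysis"
begin

definition binary_vectors :: "(int ^ 'n) set" where
  "binary_vectors = {x. \<forall>i. x $ i \<in> {0, 1}}"

(* The integer levels may differ between coordinates and need not be consecutive. *)
definition cost_grid :: "(int ^ 'n) set \<Rightarrow> bool" where
  "cost_grid \<Theta> \<longleftrightarrow>
     (\<exists>G. (\<forall>i. finite (G i) \<and> G i \<noteq> {}) \<and> \<Theta> = {c. \<forall>i. c $ i \<in> G i})"

(* The order on vectors is componentwise, so lo and hi are the vectors of lower and upper
   interval ends; lo \<le> hi makes a box nonempty. *)
definition cost_box :: "(int ^ 'n) set \<Rightarrow> (int ^ 'n) set \<Rightarrow> bool" where
  "cost_box \<Theta> F \<longleftrightarrow> (\<exists>lo\<in>\<Theta>. \<exists>hi\<in>\<Theta>. lo \<le> hi \<and> F = {lo..hi} \<inter> \<Theta>)"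

definition focal_elements :: "('c set \<Rightarrow> real) \<Rightarrow> 'c set set" where
  "focal_elements m = {F. m F \<noteq> 0}"

definition mass_function :: "(int ^ 'n) set \<Rightarrow> ((int ^ 'n) set \<Rightarrow> real) \<Rightarrow> bool" where
  "mass_function \<Theta> m \<longleftrightarrow>
     (\<forall>F. 0 \<le> m F) \<and>
     finite (focal_elements m) \<and>
     (\<forall>F\<in>focal_elements m. cost_box \<Theta> F) \<and>
     (\<Sum>F\<in>focal_elements m. m F) = 1"

definition criterion_gap :: "('x \<Rightarrow> 'm \<Rightarrow> real) \<Rightarrow> 'm \<Rightarrow> 'm \<Rightarrow> 'x \<Rightarrow> real" where
  "criterion_gap Crit m mh x = Crit x mh - Crit x m"

definition monotone_approximation ::
    "'x set \<Rightarrow> ('x \<Rightarrow> 'm \<Rightarrow> real) \<Rightarrow> 'm \<Rightarrow> 'm \<Rightarrow> bool" where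
  "monotone_approximation X Crit m mh \<longleftrightarrow> (\<forall>x\<in>X. 0 \<le> criterion_gap Crit m mh x)"

(* xstar maps a mass function to the decision taken under it; both decisions are evaluated
   under the true m. *)
definition approximation_regret ::
    "('x \<Rightarrow> 'm \<Rightarrow> real) \<Rightarrow> ('m \<Rightarrow> 'x) \<Rightarrow> 'm \<Rightarrow> 'm \<Rightarrow> real" where
  "approximation_regret Crit xstar m mh = Crit (xstar mh) m - Crit (xstar m) m"

end

theory Submission
  imports Defs
begin

text \<open>The pivot is the optimal value \<open>Crit (xstar mh) mh\<close>: it lies above the true
  value of the decision \<open>xstar mh\<close> and below the approximate value of
  \<open>xstar m\<close>. Subtracting \<open>Crit (xstar m) m\<close> from both ends of this chain
  leaves the regret and the gap.\<close>

theorem theorem1: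
  fixes X :: "(int ^ 'n) set"
    and \<Theta> :: "(int ^ 'n) set"
    and m mh :: "(int ^ 'n) set \<Rightarrow> real"
    and Crit :: "int ^ 'n \<Rightarrow> ((int ^ 'n) set \<Rightarrow> real) \<Rightarrow> real"
    and xstar :: "((int ^ 'n) set \<Rightarrow> real) \<Rightarrow> int ^ 'n"
  assumes "X \<subseteq> binary_vectors" and "X \<noteq> {}"
    and "cost_grid \<Theta>"
    and "mass_function \<Theta> m" and "mass_function \<Theta> mh"
    and "monotone_approximation X Crit m mh"
    and "is_arg_min (\<lambda>x. Crit x m) (\<lambda>x. x \<in> X) (xstar m)"
    and "is_arg_min (\<lambda>x. Crit x mh) (\<lambda>x. x \<in> X) (xstar mh)"
  shows "approximation_regret Crit xstar m mh \<le> criterion_gap Crit m mh (xstar m)"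
proof -
  \<comment> \<open>Monotonicity at \<open>xstar mh\<close>, which is feasible as a
    minimiser.\<close>
  have "Crit (xstar mh) m \<le> Crit (xstar mh) mh"
    using assms(6,8)
    by (auto simp: monotone_approximation_def criterion_gap_def is_arg_min_def)
  \<comment> \<open>Optimality of \<open>xstar mh\<close> under \<open>mh\<close>, tested against
    the feasible point \<open>xstar m\<close>; linearity of the order turns "not smaller" into
    \<le>.\<close>
  also have "\<dots> \<le> Crit (xstar m) mh"
    using assms(7,8) by (auto simp: is_arg_min_linorder)
  finally show ?thesis
    by (simp add: approximation_regret_def criterion_gap_def)
qed

end
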